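(* Let $M$ be a manifold and let $\mathcal H$ be a (possibly nonlinear) connection on $M$ with associated covariant derivative $\nabla$. A curve $c$ in $M$ is a geodesic of $\mathcal H$ if and only if $\nabla_{\dot c}\,\dot c=0$.
   Context: $M$ is a smooth, finite-dimensional, Hausdorff, paracompact, connected manifold; all objects are smooth. $\pi:TM\to M$ is the projection; $\pi_T:TTM\to TM$ is the usual tangent bundle projection and $\pi_*:TTM\to TM$ the tangent map of $\pi$. The vertical bundle is $\mathcal V=\ker\pi_*$. A connection is a smooth subbundle $\mathcal H$ of $\pi_T:TTM\to TM$ with $TTM=\mathcal H\oplus\mathcal V$. $H$ denotes the projection of $TTM$ onto $\mathcal H$ along $\mathcal V$, with $H_v:T_vTM\to\mathcal H_v$. $K:\mathcal V\to TM$ is the canonical map which on $\mathcal V_v=T_v(T_pM)$ is the canonical identification with $T_pM$. The connector is $\kappa:TTM\to TM$, $\kappa(z)=K(z-H_vz)$ for $z\in T_vTM$, and the associated covariant derivative is $\nabla_UV=\kappa(V_*U)$ for vector fields $U,V$ on $M$, where $V_*$ is the tangent map of $V:M\to TM$. Along a curve $c$, $\nabla_{\dot c}\dot c=\kappa(\dot c_*\dot c)$, where $\dot c_*\dot c$ means the velocity $\ddot c$ (in $TTM$) of the canonical lift $\dot c$ of $c$ to $TM$. The geodesic quasispray of $\mathcal H$ is the vector field on $TM$ given by $S(v)=(\pi_*|_{\mathcal H_v})^{-1}(v)$, $v\in TM$. A geodesic of $\mathcal H$ is a curve $c$ in $M$ such that $\dot c$ is an integral curve of $S$, i.e. $\ddot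 c=S(\dot c)$. *)

theory Defs
  imports "HOL-Analysis.Analysis"
begin

(* C^k on an open set S. In finite dimension, continuity of all iterated directional derivatives
   up to order k is the usual notion. *)
primrec Ck_on :: "nat \<Rightarrow> 'a::real_normed_vector set \<Rightarrow> ('a \<Rightarrow> 'b::real_normed_vector) \<Rightarrow> bool" where
  "Ck_on 0 S f \<longleftrightarrow> continuous_on S f"
| "Ck_on (Suc k) S f \<longleftrightarrow>
     (\<forall>x\<in>S. f differentiable (at x)) \<and>
     (\<forall>w. Ck_on k S (\<lambda>x. frechet_derivative f (at x) w))"

definition smooth_on :: "'a::real_normed_vector set \<Rightarrow> ('a \<Rightarrow> 'b::real_normed_vector) \<Rightarrow> bool" where
  "smooth_on S f \<longleftrightarrow> open S \<and> (\<forall>k. Ck_on k S f)"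

definition paracompact_space :: "'a topology \<Rightarrow> bool" where
  "paracompact_space X \<longleftrightarrow>
     (\<forall>\<U>. (\<forall>U\<in>\<U>. openin X U) \<and> \<Union>\<U> = topspace X \<longrightarrow>
       (\<exists>\<V>. (\<forall>V\<in>\<V>. openin X V) \<and> \<Union>\<V> = topspace X \<and>
         (\<forall>V\<in>\<V>. \<exists>U\<in>\<U>. V \<subseteq> U) \<and> locally_finite_in X \<V>))"

(* A chart is a pair of its domain and its coordinate map; the values of the coordinate map
   outside the domain are irrelevant. *)
type_synonym ('a, 'e) chart = "'a set \<times> ('a \<Rightarrow> 'e)"

record ('a, 'e) manifold =
  mtop :: "'a topology"
  atlas :: "('a, 'e) chart set"

definition charts_at :: "('a, 'e) manifold \<Rightarrow> 'a \<Rightarrow> ('a, 'e) chart set" where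
  "charts_at M p = {ch \<in> atlas M. p \<in> fst ch}"

definition transition :: "('a, 'e) chart \<Rightarrow> ('a, 'e) chart \<Rightarrow> 'e \<Rightarrow> 'e" where
  "transition ch ch' = (\<lambda>x. snd ch' (inv_into (fst ch) (snd ch) x))"

(* The model space is a finite-dimensional inner product space rather than of class
   euclidean_space, because that class excludes dimension 0. *)
definition smooth_manifold :: "('a, 'e::real_inner) manifold \<Rightarrow> bool" where
  "smooth_manifold M \<longleftrightarrow>
     (\<exists>B::'e set. finite B \<and> span B = UNIV) \<and>
     Hausdorff_space (mtop M) \<and> paracompact_space (mtop M) \<and> connected_space (mtop M) \<and>
     (\<Union>ch\<in>atlas M. fst ch) = topspace (mtop M) \<and>
     (\<forall>(U, \<phi>)\<in>atlas M. openin (mtop M) U \<and> open (\<phi> ` U) \<and>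
        homeomorphic_map (subtopology (mtop M) U) (top_of_set (\<phi> ` U)) \<phi>) \<and>
     (\<forall>ch\<in>atlas M. \<forall>ch'\<in>atlas M.
        smooth_on (snd ch ` (fst ch \<inter> fst ch')) (transition ch ch'))"

definition euclidean_manifold :: "('e::real_normed_vector, 'e) manifold" where
  "euclidean_manifold = \<lparr>mtop = euclidean, atlas = {(UNIV, id)}\<rparr>"

definition smooth_map_on ::
  "('a, 'e::real_normed_vector) manifold \<Rightarrow> ('b, 'f::real_normed_vector) manifold \<Rightarrow>
   'a set \<Rightarrow> ('a \<Rightarrow> 'b) \<Rightarrow> bool" where
  "smooth_map_on M N W f \<longleftrightarrow> openin (mtop M) W \<and>
     (\<forall>p\<in>W. \<exists>(U, \<phi>)\<in>charts_at M p. \<exists>(V, \<psi>)\<in>charts_at N (f p). \<exists>W'.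
        openin (mtop M) W' \<and> p \<in> W' \<and> W' \<subseteq> W \<inter> U \<and> f ` W' \<subseteq> V \<and>
        smooth_on (\<phi> ` W') (\<lambda>x. \<psi> (f (inv_into U \<phi> x))))"

(* A tangent vector consists of its base point and its coordinate vectors with respect to all
   charts around the base point, related by the derivatives of the transition maps. The value 0
   at all other charts makes equality of tangent vectors extensional. *)
datatype ('a, 'e) tvec = TVec (foot: 'a) (coords: "('a, 'e) chart \<Rightarrow> 'e")

definition tangent_vectors :: "('a, 'e::real_normed_vector) manifold \<Rightarrow> ('a, 'e) tvec set" where
  "tangent_vectors M = {v. foot v \<in> topspace (mtop M) \<and>
     (\<forall>ch. ch \<notin> charts_at M (foot v) \<longrightarrow> coords v ch = 0) \<and>
     (\<forall>ch\<in>charts_at M (foot v). \<forall>ch'\<in>charts_at M (foot v).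
        coords v ch' = frechet_derivative (transition ch ch') (at (snd ch (foot v))) (coords v ch))}"

definition tangent_space ::
  "('a, 'e::real_normed_vector) manifold \<Rightarrow> 'a \<Rightarrow> ('a, 'e) tvec set" where
  "tangent_space M p = {v \<in> tangent_vectors M. foot v = p}"

definition tzero :: "'a \<Rightarrow> ('a, 'e::real_vector) tvec" where
  "tzero p = TVec p (\<lambda>_. 0)"

(* Vector space operations, meaningful for vectors with the same base point. *)
definition tadd :: "('a, 'e::real_vector) tvec \<Rightarrow> ('a, 'e) tvec \<Rightarrow> ('a, 'e) tvec" where
  "tadd u v = TVec (foot u) (\<lambda>ch. coords u ch + coords v ch)"

definition tminus :: "('a, 'e::real_vector) tvec \<Rightarrow> ('a, 'e) tvec \<Rightarrow> ('a, 'e) tvec" where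
  "tminus u v = TVec (foot u) (\<lambda>ch. coords u ch - coords v ch)"

definition tscale :: "real \<Rightarrow> ('a, 'e::real_vector) tvec \<Rightarrow> ('a, 'e) tvec" where
  "tscale a v = TVec (foot v) (\<lambda>ch. a *\<^sub>R coords v ch)"

definition tlincomb ::
  "'a \<Rightarrow> nat \<Rightarrow> (nat \<Rightarrow> real) \<Rightarrow> (nat \<Rightarrow> ('a, 'e::real_vector) tvec) \<Rightarrow> ('a, 'e) tvec" where
  "tlincomb p k a X = TVec p (\<lambda>ch. \<Sum>i<k. a i *\<^sub>R coords (X i) ch)"

definition tangent_chart ::
  "('a, 'e::real_normed_vector) manifold \<Rightarrow> ('a, 'e) chart \<Rightarrow> (('a, 'e) tvec, 'e \<times> 'e) chart" where
  "tangent_chart M ch =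
     ({v \<in> tangent_vectors M. foot v \<in> fst ch}, \<lambda>v. (snd ch (foot v), coords v ch))"

definition tangent_bundle ::
  "('a, 'e::real_normed_vector) manifold \<Rightarrow> (('a, 'e) tvec, 'e \<times> 'e) manifold" where
  "tangent_bundle M =
     \<lparr>mtop = topology_generated_by
        {{v \<in> fst (tangent_chart M ch). snd (tangent_chart M ch) v \<in> Q} | ch Q.
           ch \<in> atlas M \<and> open Q},
      atlas = tangent_chart M ` atlas M\<rparr>"

(* The tangent map of f. Its value does not depend on the chart ch chosen around the base point
   when f is differentiable there. *)
definition tangent_map ::
  "('a, 'e::real_normed_vector) manifold \<Rightarrow> ('b, 'f::real_normed_vector) manifold \<Rightarrow>
   ('a \<Rightarrow> 'b) \<Rightarrow> ('a, 'e) tvec \<Rightarrow> ('b, 'f) tvec" where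
  "tangent_map M N f v =
     (let ch = (SOME ch. ch \<in> charts_at M (foot v)) in
      TVec (f (foot v)) (\<lambda>ch'. if ch' \<in> charts_at N (f (foot v))
        then frechet_derivative (\<lambda>x. snd ch' (f (inv_into (fst ch) (snd ch) x)))
               (at (snd ch (foot v))) (coords v ch)
        else 0))"

definition smooth_curve ::
  "('a, 'e::real_normed_vector) manifold \<Rightarrow> real set \<Rightarrow> (real \<Rightarrow> 'a) \<Rightarrow> bool" where
  "smooth_curve M I c \<longleftrightarrow> open I \<and> is_interval I \<and> smooth_map_on euclidean_manifold M I c"

(* As a function of t this is also the canonical lift of c to the tangent bundle. *)
definition velocity ::
  "('a, 'e::real_normed_vector) manifold \<Rightarrow> (real \<Rightarrow> 'a) \<Rightarrow> real \<Rightarrow> ('a, 'e) tvec" where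
  "velocity M c t = TVec (c t) (\<lambda>ch. if ch \<in> charts_at M (c t)
     then vector_derivative (\<lambda>s. snd ch (c s)) (at t) else 0)"

definition integral_curve ::
  "('a, 'e::real_normed_vector) manifold \<Rightarrow> ('a \<Rightarrow> ('a, 'e) tvec) \<Rightarrow> real set \<Rightarrow>
   (real \<Rightarrow> 'a) \<Rightarrow> bool" where
  "integral_curve M X I c \<longleftrightarrow> smooth_curve M I c \<and> (\<forall>t\<in>I. velocity M c t = X (c t))"

definition fiber :: "('a, 'e) tvec set \<Rightarrow> 'a \<Rightarrow> ('a, 'e) tvec set" where
  "fiber E p = {z \<in> E. foot z = p}"

(* A smooth subbundle of TM of constant rank, given by smooth local frames. *)
definition smooth_subbundle ::
  "('a, 'e::real_normed_vector) manifold \<Rightarrow> ('a, 'e) tvec set \<Rightarrow> bool" where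
  "smooth_subbundle M E \<longleftrightarrow> E \<subseteq> tangent_vectors M \<and>
     (\<exists>k. \<forall>p\<in>topspace (mtop M). \<exists>W X. openin (mtop M) W \<and> p \<in> W \<and>
        (\<forall>i<k. smooth_map_on M (tangent_bundle M) W (X i) \<and>
               (\<forall>q\<in>W. X i q \<in> tangent_space M q)) \<and>
        (\<forall>q\<in>W. fiber E q = range (\<lambda>a. tlincomb q k a (\<lambda>i. X i q)) \<and>
           (\<forall>a. tlincomb q k a (\<lambda>i. X i q) = tzero q \<longrightarrow> (\<forall>i<k. a i = 0))))"

type_synonym ('a, 'e) ttvec = "(('a, 'e) tvec, 'e \<times> 'e) tvec"

(* The tangent map of the projection foot: TM -> M. *)
definition proj_map ::
  "('a, 'e::real_normed_vector) manifold \<Rightarrow> ('a, 'e) ttvec \<Rightarrow> ('a, 'e) tvec" where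
  "proj_map M = tangent_map (tangent_bundle M) M foot"

definition vertical_bundle ::
  "('a, 'e::real_normed_vector) manifold \<Rightarrow> ('a, 'e) ttvec set" where
  "vertical_bundle M = {z \<in> tangent_vectors (tangent_bundle M).
     proj_map M z = tzero (foot (foot z))}"

definition connection ::
  "('a, 'e::real_normed_vector) manifold \<Rightarrow> ('a, 'e) ttvec set \<Rightarrow> bool" where
  "connection M H \<longleftrightarrow> smooth_subbundle (tangent_bundle M) H \<and>
     (\<forall>v\<in>tangent_vectors M.
        {tadd h y | h y. h \<in> fiber H v \<and> y \<in> fiber (vertical_bundle M) v} =
          tangent_space (tangent_bundle M) v \<and>
        fiber H v \<inter> fiber (vertical_bundle M) v = {tzero v})"

definition horizontal_part ::
  "('a, 'e::real_normed_vector) manifold \<Rightarrow> ('a, 'e) ttvec set \<Rightarrow> ('a, 'e) ttvec \<Rightarrow> ('a, 'e) ttvec"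
  where
  "horizontal_part M H z = (THE h. h \<in> fiber H (foot z) \<and>
     (\<exists>y\<in>fiber (vertical_bundle M) (foot z). z = tadd h y))"

(* The canonical isomorphism from the tangent space at p = foot v onto its own tangent space
   at v, the latter viewed inside the tangent space of TM at v. *)
definition vertical_lift ::
  "('a, 'e::real_normed_vector) manifold \<Rightarrow> ('a, 'e) tvec \<Rightarrow> ('a, 'e) tvec \<Rightarrow> ('a, 'e) ttvec" where
  "vertical_lift M v w = velocity (tangent_bundle M) (\<lambda>s. tadd v (tscale s w)) 0"

definition vertical_ident ::
  "('a, 'e::real_normed_vector) manifold \<Rightarrow> ('a, 'e) ttvec \<Rightarrow> ('a, 'e) tvec" where
  "vertical_ident M z =
     (THE w. w \<in> tangent_space M (foot (foot z)) \<and> vertical_lift M (foot z) w = z)"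

definition connector ::
  "('a, 'e::real_normed_vector) manifold \<Rightarrow> ('a, 'e) ttvec set \<Rightarrow> ('a, 'e) ttvec \<Rightarrow> ('a, 'e) tvec"
  where
  "connector M H z = vertical_ident M (tminus z (horizontal_part M H z))"

definition covariant_derivative ::
  "('a, 'e::real_normed_vector) manifold \<Rightarrow> ('a, 'e) ttvec set \<Rightarrow>
   ('a \<Rightarrow> ('a, 'e) tvec) \<Rightarrow> ('a \<Rightarrow> ('a, 'e) tvec) \<Rightarrow> 'a \<Rightarrow> ('a, 'e) tvec" where
  "covariant_derivative M H U V p = connector M H (tangent_map M (tangent_bundle M) V (U p))"

(* The covariant derivative of a vector field X along a curve c in the direction of the velocity
   of c; the curve is recovered as c t = foot (X t). *)
definition covariant_derivative_along ::
  "('a, 'e::real_normed_vector) manifold \<Rightarrow> ('a, 'e) ttvec set \<Rightarrow>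
   (real \<Rightarrow> ('a, 'e) tvec) \<Rightarrow> real \<Rightarrow> ('a, 'e) tvec" where
  "covariant_derivative_along M H X t = connector M H (velocity (tangent_bundle M) X t)"

definition geodesic_quasispray ::
  "('a, 'e::real_normed_vector) manifold \<Rightarrow> ('a, 'e) ttvec set \<Rightarrow> ('a, 'e) tvec \<Rightarrow> ('a, 'e) ttvec"
  where
  "geodesic_quasispray M H v = inv_into (fiber H v) (proj_map M) v"

definition geodesic ::
  "('a, 'e::real_normed_vector) manifold \<Rightarrow> ('a, 'e) ttvec set \<Rightarrow> real set \<Rightarrow>
   (real \<Rightarrow> 'a) \<Rightarrow> bool" where
  "geodesic M H I c \<longleftrightarrow> smooth_curve M I c \<and>
     integral_curve (tangent_bundle M) (geodesic_quasispray M H) I (velocity M c)"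

end

theory Submission
  imports Defs
begin

text \<open>In a chart, the acceleration \<open>z\<close> of a curve \<open>c\<close> is the derivative of \<open>(x, x')\<close>, so the tangent
map of the projection sends \<open>z\<close> to \<open>x' = c'\<close>. As the vertical space is the kernel of this map and is
complementary to the horizontal space, \<open>S (c')\<close> is the only horizontal vector lying over \<open>c'\<close>; hence
\<open>z = S (c')\<close> iff \<open>z\<close> is horizontal. The connector is the injective vertical identification applied to
the vertical part of \<open>z\<close>, so it vanishes at \<open>z\<close> iff \<open>z\<close> is horizontal as well.\<close>

section \<open>Differentiability\<close>

text \<open>Since \<open>S\<close> is open, agreement on \<open>S\<close> passes to the derivatives
  at its points. The induction is then applied to directional derivatives, hence the generalization
  over \<open>f\<close> and \<open>g\<close>.\<close>

lemma Ck_on_cong: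
  assumes "open S" "\<And>x. x \<in> S \<Longrightarrow> f x = g x" "Ck_on k S f"
  shows "Ck_on k S g"
  using assms(2,3)
proof (induction k arbitrary: f g)
  case 0
  then show ?case by (simp cong: continuous_on_cong)
next
  case (Suc k)
  have D: "(g has_derivative frechet_derivative f (at x)) (at x)" if "x \<in> S" for x
    using Suc.prems that assms(1)
    by (intro has_derivative_transform_within_open[of f _ x UNIV S g])
       (auto simp: frechet_derivative_works)
  have "frechet_derivative f (at x) = frechet_derivative g (at x)" if "x \<in> S" for x
    using frechet_derivative_at[OF D[OF that]] .
  moreover have "Ck_on k S (\<lambda>x. frechet_derivative f (at x) w)" for w
    using Suc.prems by auto
  ultimately have "Ck_on k S (\<lambda>x. frechet_derivative g (at x) w)" for w
    using Suc.IH[of "\<lambda>x. frechet_derivative f (at x) w" "\<lambda>x. frechet_derivative g (at x) w"] by simp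
  then show ?case using D by (auto simp: differentiable_def)
qed

lemma Ck_on_Pair:
  assumes "open S" "Ck_on k S f" "Ck_on k S g"
  shows "Ck_on k S (\<lambda>x. (f x, g x))"
  using assms(2,3)
proof (induction k arbitrary: f g)
  case 0
  then show ?case by (simp add: continuous_on_Pair)
next
  case (Suc k)
  have D: "((\<lambda>x. (f x, g x)) has_derivative
      (\<lambda>w. (frechet_derivative f (at x) w, frechet_derivative g (at x) w))) (at x)"
    if "x \<in> S" for x
    using Suc.prems that by (intro has_derivative_Pair) (auto simp: frechet_derivative_works)
  have "Ck_on k S (\<lambda>x. frechet_derivative (\<lambda>x. (f x, g x)) (at x) w)" for w
  proof (rule Ck_on_cong[OF assms(1)])
    show "Ck_on k S (\<lambda>x. (frechet_derivative f (at x) w, frechet_derivative g (at x) w))"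
      using Suc.prems by (intro Suc.IH) auto
    show "(frechet_derivative f (at x) w, frechet_derivative g (at x) w) =
        frechet_derivative (\<lambda>x. (f x, g x)) (at x) w" if "x \<in> S" for x
      using frechet_derivative_at[OF D[OF that]] by (metis (no_types, lifting))
  qed
  then show ?case using D by (auto simp: differentiable_def)
qed

text \<open>For a function of a real variable the vector derivative is the directional derivative
  along 1, so the recursion of \<open>Ck_on\<close> applies.\<close>

lemma Ck_on_vector_derivative:
  assumes "open S" "Ck_on (Suc k) S f"
  shows "Ck_on k S (\<lambda>x. vector_derivative f (at x))"
proof (rule Ck_on_cong[OF assms(1)])
  show "Ck_on k S (\<lambda>x. frechet_derivative f (at x) 1)" using assms(2) by simp
  show "frechet_derivative f (at x) 1 = vector_derivative f (at x)" if "x \<in> S" for x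
  proof -
    have "f differentiable (at x)" using assms(2) that by simp
    then show ?thesis
      by (metis frechet_derivative_at has_vector_derivative_def scaleR_one
          vector_derivative_works)
  qed
qed

lemma vector_derivative_transform_within_open:
  assumes "open S" "t \<in> S" "\<And>s. s \<in> S \<Longrightarrow> f s = g s"
    and "(f has_vector_derivative d) (at t)"
  shows "(g has_vector_derivative d) (at t)"
  using has_derivative_transform_within_open[of f _ t UNIV S g] assms
  unfolding has_vector_derivative_def by blast

text \<open>The difference of both sides lies in \<open>span C\<close> and is orthogonal to
  \<open>C\<close>, hence to itself. A zero vector in \<open>C\<close> does no harm, as its term is
  0. A finite orthogonal set takes the place of a fixed basis because the model space need not be of
  class \<open>euclidean_space\<close>.\<close>

lemma orthogonal_expansion:
  fixes C :: "'e::real_inner set"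
  assumes "finite C" "pairwise orthogonal C" "w \<in> span C"
  shows "w = (\<Sum>c\<in>C. (w \<bullet> c / (c \<bullet> c)) *\<^sub>R c)"
proof -
  let ?d = "w - (\<Sum>c\<in>C. (w \<bullet> c / (c \<bullet> c)) *\<^sub>R c)"
  have "?d \<in> span C"
    using assms by (auto intro!: span_diff span_sum span_scale intro: span_base)
  moreover have "\<And>x. x \<in> span C \<Longrightarrow> orthogonal ?d x"
  proof (rule orthogonal_to_span)
    fix b assume "b \<in> C"
    have "(\<Sum>c\<in>C. (w \<bullet> c / (c \<bullet> c)) *\<^sub>R c) \<bullet> b = (\<Sum>c\<in>C. if c = b then w \<bullet> b else 0)"
      unfolding inner_sum_left
      using assms(2) \<open>b \<in> C\<close>
      by (intro sum.cong) (auto simp: pairwise_def orthogonal_def)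
    then show "orthogonal ?d b"
      using assms(1) \<open>b \<in> C\<close> by (simp add: orthogonal_def inner_diff_left)
  qed
  ultimately have "orthogonal ?d ?d" by blast
  then show ?thesis by (simp add: orthogonal_self)
qed

section \<open>Tangent vectors in charts\<close>

lemma tvec_eqI: "foot u = foot v \<Longrightarrow> (\<And>ch. coords u ch = coords v ch) \<Longrightarrow> u = v"
  by (cases u; cases v) auto

lemma foot_simps [simp]:
  "foot (tzero p) = p" "foot (tadd u v) = foot u" "foot (tminus u v) = foot u"
  "foot (tscale a u) = foot u" "foot (velocity M \<gamma> t) = \<gamma> t" "foot (tlincomb p k r X) = p"
  by (simp_all add: tzero_def tadd_def tminus_def tscale_def velocity_def tlincomb_def)

lemma coords_simps [simp]:
  "coords (tzero p) ch = 0" "coords (tadd u v) ch = coords u ch + coords v ch"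
  "coords (tminus u v) ch = coords u ch - coords v ch"
  "coords (tscale a u) ch = a *\<^sub>R coords u ch"
  by (simp_all add: tzero_def tadd_def tminus_def tscale_def)

lemma tminus_eq_tzeroD: "tminus u v = tzero p \<Longrightarrow> foot u = foot v \<Longrightarrow> u = v"
  by (rule tvec_eqI) (auto simp: tminus_def tzero_def fun_eq_iff)

text \<open>The part of the manifold axioms that tangent vectors rely on, weak enough to be verified for
  \<open>TM\<close> without proving that \<open>TM\<close> is a smooth manifold.\<close>

locale c1_manifold =
  fixes M :: "('a, 'e::real_normed_vector) manifold"
  assumes topspace_eq: "topspace (mtop M) = (\<Union>ch\<in>atlas M. fst ch)"
    and chart_inj: "ch \<in> atlas M \<Longrightarrow> inj_on (snd ch) (fst ch)"
    and overlap_open: "ch \<in> atlas M \<Longrightarrow> ch' \<in> atlas M \<Longrightarrow> open (snd ch ` (fst ch \<inter> fst ch'))"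
    and transition_differentiable:
      "ch \<in> charts_at M p \<Longrightarrow> ch' \<in> charts_at M p \<Longrightarrow> transition ch ch' differentiable (at (snd ch p))"
begin

abbreviation dtrans :: "('a, 'e) chart \<Rightarrow> ('a, 'e) chart \<Rightarrow> 'a \<Rightarrow> 'e \<Rightarrow> 'e" where
  "dtrans ch ch' p \<equiv> frechet_derivative (transition ch ch') (at (snd ch p))"

lemma charts_at_topspace: "ch \<in> charts_at M p \<Longrightarrow> p \<in> topspace (mtop M)"
  by (auto simp: charts_at_def topspace_eq)

lemma charts_at_exists:
  assumes "p \<in> topspace (mtop M)" obtains ch where "ch \<in> charts_at M p"
  using assms by (auto simp: charts_at_def topspace_eq)

lemma inv_chart: "ch \<in> charts_at M p \<Longrightarrow> inv_into (fst ch) (snd ch) (snd ch p) = p"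
  using chart_inj by (auto simp: charts_at_def)

lemma transition_chart: "ch \<in> charts_at M p \<Longrightarrow> transition ch ch' (snd ch p) = snd ch' p"
  by (simp add: transition_def inv_chart)

lemma transition_has_derivative:
  "ch \<in> charts_at M p \<Longrightarrow> ch' \<in> charts_at M p \<Longrightarrow>
    (transition ch ch' has_derivative dtrans ch ch' p) (at (snd ch p))"
  using transition_differentiable frechet_derivative_works by blast

lemma dtrans_linear: "ch \<in> charts_at M p \<Longrightarrow> ch' \<in> charts_at M p \<Longrightarrow> linear (dtrans ch ch' p)"
  using transition_has_derivative has_derivative_linear by blast

text \<open>Chain rule: near \<open>snd ch p\<close>, changing from \<open>ch\<close> to
  \<open>ch'\<close> and then to \<open>ch''\<close> is the direct change to
  \<open>ch''\<close>.\<close>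

lemma dtrans_cocycle:
  assumes "ch \<in> charts_at M p" "ch' \<in> charts_at M p" "ch'' \<in> charts_at M p"
  shows "dtrans ch' ch'' p (dtrans ch ch' p w) = dtrans ch ch'' p w"
proof -
  \<comment> \<open>As \<open>snd ch\<close> is injective on its domain, this is the coordinate
    image of the triple overlap. Written as an intersection, it is open by
    \<open>overlap_open\<close>.\<close>
  let ?S = "snd ch ` (fst ch \<inter> fst ch') \<inter> snd ch ` (fst ch \<inter> fst ch'')"
  have A: "ch \<in> atlas M" "ch' \<in> atlas M" "ch'' \<in> atlas M"
    "p \<in> fst ch" "p \<in> fst ch'" "p \<in> fst ch''"
    using assms by (auto simp: charts_at_def)
  have "((\<lambda>x. transition ch' ch'' (transition ch ch' x)) has_derivative
      (\<lambda>w. dtrans ch' ch'' p (dtrans ch ch' p w))) (at (snd ch p))"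
    using has_derivative_compose[OF transition_has_derivative[OF assms(1,2)],
        of "transition ch' ch''"] transition_has_derivative[OF assms(2,3)]
      transition_chart[OF assms(1)] by simp
  moreover have "open ?S" "snd ch p \<in> ?S" using A by (auto intro: overlap_open)
  moreover have "transition ch' ch'' (transition ch ch' x) = transition ch ch'' x" if x: "x \<in> ?S" for x
  proof -
    obtain q where "x = snd ch q" "q \<in> fst ch" "q \<in> fst ch'"
      using x by auto
    then have "ch \<in> charts_at M q" "ch' \<in> charts_at M q" "x = snd ch q"
      using A by (auto simp: charts_at_def)
    then show ?thesis by (simp add: transition_chart)
  qed
  ultimately have "(transition ch ch'' has_derivative
      (\<lambda>w. dtrans ch' ch'' p (dtrans ch ch' p w))) (at (snd ch p))"
    by (rule has_derivative_transform_within_open)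
  from frechet_derivative_at[OF this] show ?thesis by metis
qed

lemma dtrans_self:
  assumes "ch \<in> charts_at M p"
  shows "dtrans ch ch p w = w"
proof -
  have A: "ch \<in> atlas M" "p \<in> fst ch" using assms by (auto simp: charts_at_def)
  have "(transition ch ch has_derivative (\<lambda>w. w)) (at (snd ch p))"
  proof (rule has_derivative_transform_within_open)
    show "((\<lambda>x. x) has_derivative (\<lambda>w. w)) (at (snd ch p))" by simp
    show "open (snd ch ` (fst ch \<inter> fst ch))" using A overlap_open by blast
    show "snd ch p \<in> snd ch ` (fst ch \<inter> fst ch)" using A by blast
    show "x = transition ch ch x" if "x \<in> snd ch ` (fst ch \<inter> fst ch)" for x
      using that A by (auto simp: charts_at_def transition_chart)
  qed
  from frechet_derivative_at[OF this] show ?thesis by metis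
qed

lemma tangent_vectorsI:
  assumes "foot v \<in> topspace (mtop M)"
    and "\<And>ch. ch \<notin> charts_at M (foot v) \<Longrightarrow> coords v ch = 0"
    and "\<And>ch ch'. ch \<in> charts_at M (foot v) \<Longrightarrow> ch' \<in> charts_at M (foot v) \<Longrightarrow>
      coords v ch' = dtrans ch ch' (foot v) (coords v ch)"
  shows "v \<in> tangent_vectors M"
  unfolding tangent_vectors_def using assms by blast

lemma foot_topspace: "v \<in> tangent_vectors M \<Longrightarrow> foot v \<in> topspace (mtop M)"
  by (simp add: tangent_vectors_def)

lemma coords_outside: "v \<in> tangent_vectors M \<Longrightarrow> ch \<notin> charts_at M (foot v) \<Longrightarrow> coords v ch = 0"
  unfolding tangent_vectors_def by blast

lemma coords_transform:
  "v \<in> tangent_vectors M \<Longrightarrow> ch \<in> charts_at M (foot v) \<Longrightarrow> ch' \<in> charts_at M (foot v) \<Longrightarrow>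
    coords v ch' = dtrans ch ch' (foot v) (coords v ch)"
  unfolding tangent_vectors_def by blast

text \<open>Transporting \<open>w\<close> from \<open>ch\<close> to every other chart at
  \<open>p\<close> works: the cocycle rule gives compatibility of any two charts, and
  \<open>dtrans_self\<close> returns \<open>w\<close> in \<open>ch\<close>.\<close>

lemma tangent_vector_with_coords:
  assumes "ch \<in> charts_at M p"
  obtains u where "u \<in> tangent_vectors M" "foot u = p" "coords u ch = w"
proof
  let ?u = "TVec p (\<lambda>ch'. if ch' \<in> charts_at M p then dtrans ch ch' p w else 0)"
  show "?u \<in> tangent_vectors M"
    using assms by (intro tangent_vectorsI) (auto simp: charts_at_topspace dtrans_cocycle)
  show "coords ?u ch = w" using assms by (simp add: dtrans_self)
qed simp

text \<open>One chart suffices: it determines the coordinates in all charts at the foot, and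
  elsewhere they are 0.\<close>

lemma tangent_vector_eqI:
  assumes "u \<in> tangent_vectors M" "v \<in> tangent_vectors M" "foot u = foot v"
    "ch \<in> charts_at M (foot u)" "coords u ch = coords v ch"
  shows "u = v"
proof (rule tvec_eqI)
  show "coords u ch' = coords v ch'" for ch'
    using assms coords_transform[of u ch ch'] coords_transform[of v ch ch']
    by (cases "ch' \<in> charts_at M (foot u)") (simp_all add: coords_outside)
qed (rule assms)

lemma tangent_vectors_tminus:
  assumes "u \<in> tangent_vectors M" "v \<in> tangent_vectors M" "foot u = foot v"
  shows "tminus u v \<in> tangent_vectors M"
proof (rule tangent_vectorsI)
  fix ch ch' assume c: "ch \<in> charts_at M (foot (tminus u v))" "ch' \<in> charts_at M (foot (tminus u v))"
  then show "coords (tminus u v) ch' = dtrans ch ch' (foot (tminus u v)) (coords (tminus u v) ch)"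
    using assms coords_transform[of u ch ch'] coords_transform[of v ch ch']
    by (simp add: linear_diff[OF dtrans_linear])
qed (use assms in \<open>simp_all add: foot_topspace coords_outside\<close>)

lemma tangent_vectors_tzero: "p \<in> topspace (mtop M) \<Longrightarrow> tzero p \<in> tangent_vectors M"
  by (intro tangent_vectorsI) (simp_all add: linear_0[OF dtrans_linear])

text \<open>Chain rule: near \<open>t\<close>, the curve read in \<open>ch'\<close> is
  \<open>transition ch ch'\<close> applied to the curve read in \<open>ch\<close>. This makes the
  chartwise derivatives stored in \<open>velocity\<close> compatible.\<close>

lemma curve_has_vector_derivative:
  assumes "ch \<in> charts_at M (\<gamma> t)" "ch' \<in> charts_at M (\<gamma> t)"
    and "open W" "t \<in> W" "\<And>s. s \<in> W \<Longrightarrow> \<gamma> s \<in> fst ch"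
    and cont: "continuous_on W (\<lambda>s. snd ch (\<gamma> s))"
    and d: "((\<lambda>s. snd ch (\<gamma> s)) has_vector_derivative d) (at t)"
  shows "((\<lambda>s. snd ch' (\<gamma> s)) has_vector_derivative dtrans ch ch' (\<gamma> t) d) (at t)"
proof (rule vector_derivative_transform_within_open)
  have A: "ch \<in> atlas M" "ch' \<in> atlas M" "\<gamma> t \<in> fst ch" "\<gamma> t \<in> fst ch'"
    using assms by (auto simp: charts_at_def)
  \<comment> \<open>The times in \<open>W\<close> at which the curve is also in the domain of
    \<open>ch'\<close>; continuity makes this set open.\<close>
  let ?S = "W \<inter> (\<lambda>s. snd ch (\<gamma> s)) -` (snd ch ` (fst ch \<inter> fst ch'))"
  show "open ?S"
    using continuous_open_preimage[OF cont \<open>open W\<close> overlap_open[OF A(1,2)]] .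
  show "t \<in> ?S" using A assms by auto
  show "transition ch ch' (snd ch (\<gamma> s)) = snd ch' (\<gamma> s)" if "s \<in> ?S" for s
    using that assms(5) A by (intro transition_chart) (auto simp: charts_at_def)
  show "((\<lambda>s. transition ch ch' (snd ch (\<gamma> s))) has_vector_derivative dtrans ch ch' (\<gamma> t) d) (at t)"
    using has_derivative_compose[OF d[unfolded has_vector_derivative_def]
        transition_has_derivative[OF assms(1,2)]]
      linear_scale[OF dtrans_linear[OF assms(1,2)]]
    by (simp add: has_vector_derivative_def)
qed

lemma velocity_tangent:
  assumes "ch \<in> charts_at M (\<gamma> t)"
    and "open W" "t \<in> W" "\<And>s. s \<in> W \<Longrightarrow> \<gamma> s \<in> fst ch"
    and "continuous_on W (\<lambda>s. snd ch (\<gamma> s))"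
    and "((\<lambda>s. snd ch (\<gamma> s)) has_vector_derivative d) (at t)"
  shows "velocity M \<gamma> t \<in> tangent_vectors M"
proof -
  have "coords (velocity M \<gamma> t) ch' = dtrans ch ch' (\<gamma> t) d" if "ch' \<in> charts_at M (\<gamma> t)" for ch'
    using that vector_derivative_at[OF curve_has_vector_derivative[OF assms(1) that assms(2-6)]]
    by (simp add: velocity_def)
  moreover have "coords (velocity M \<gamma> t) ch' = 0" if "ch' \<notin> charts_at M (\<gamma> t)" for ch'
    using that by (simp add: velocity_def)
  ultimately show ?thesis
    using assms(1) by (intro tangent_vectorsI) (simp_all add: charts_at_topspace dtrans_cocycle)
qed

end

section \<open>The tangent bundle\<close>

locale smooth_mfd =
  fixes M :: "('a, 'e::real_inner) manifold"
  assumes smooth: "smooth_manifold M"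
begin

lemma transition_smooth:
  "ch \<in> atlas M \<Longrightarrow> ch' \<in> atlas M \<Longrightarrow>
    smooth_on (snd ch ` (fst ch \<inter> fst ch')) (transition ch ch')"
  using smooth unfolding smooth_manifold_def by blast

sublocale c1_manifold M
proof
  show "topspace (mtop M) = (\<Union>ch\<in>atlas M. fst ch)"
    using smooth unfolding smooth_manifold_def by simp
  show "inj_on (snd ch) (fst ch)" if ch: "ch \<in> atlas M" for ch
  proof -
    have "openin (mtop M) (fst ch)"
      "homeomorphic_map (subtopology (mtop M) (fst ch)) (top_of_set (snd ch ` fst ch)) (snd ch)"
      using smooth ch unfolding smooth_manifold_def by (auto simp: case_prod_unfold)
    then show ?thesis
      using homeomorphic_imp_injective_map openin_subset topspace_subtopology_subset by metis
  qed
  show "open (snd ch ` (fst ch \<inter> fst ch'))" if "ch \<in> atlas M" "ch' \<in> atlas M" for ch ch'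
    using transition_smooth[OF that] by (simp add: smooth_on_def)
  show "transition ch ch' differentiable (at (snd ch p))"
    if "ch \<in> charts_at M p" "ch' \<in> charts_at M p" for ch ch' p
  proof -
    have "Ck_on (Suc 0) (snd ch ` (fst ch \<inter> fst ch')) (transition ch ch')"
      using that transition_smooth[of ch ch'] unfolding smooth_on_def charts_at_def by blast
    then show ?thesis using that by (auto simp: charts_at_def)
  qed
qed

abbreviation "TM \<equiv> tangent_bundle M"
abbreviation "tch \<equiv> tangent_chart M"

lemma tch_simps [simp]:
  "fst (tch ch) = {v \<in> tangent_vectors M. foot v \<in> fst ch}"
  "snd (tch ch) v = (snd ch (foot v), coords v ch)"
  by (simp_all add: tangent_chart_def)

lemma atlas_TM: "atlas TM = tch ` atlas M"
  by (simp add: tangent_bundle_def)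

lemma charts_at_TM:
  "v \<in> tangent_vectors M \<Longrightarrow> charts_at TM v = tch ` charts_at M (foot v)"
  by (auto simp: charts_at_def atlas_TM)

lemma charts_at_TM_tangent: "T \<in> charts_at TM v \<Longrightarrow> v \<in> tangent_vectors M"
  by (auto simp: charts_at_def atlas_TM)

lemma topspace_TM_Union: "topspace (mtop TM) = (\<Union>T\<in>atlas TM. fst T)"
proof -
  have "topspace (mtop TM) =
      \<Union> {{v \<in> fst (tch ch). snd (tch ch) v \<in> Q} | ch Q. ch \<in> atlas M \<and> open Q}"
    by (simp add: tangent_bundle_def topology_generated_by_topspace)
  also have "\<dots> = (\<Union>T\<in>atlas TM. fst T)"
  proof (rule subset_antisym; rule subsetI)
    fix v assume "v \<in> (\<Union>T\<in>atlas TM. fst T)"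
    then obtain ch where "ch \<in> atlas M" "v \<in> fst (tch ch)" unfolding atlas_TM by blast
    \<comment> \<open>Taking \<open>Q = UNIV\<close> exhibits the chart domain itself as a
      generating set of the topology.\<close>
    moreover from this have "{v \<in> fst (tch ch). snd (tch ch) v \<in> UNIV} \<in>
        {{v \<in> fst (tch ch). snd (tch ch) v \<in> Q} | ch Q. ch \<in> atlas M \<and> open Q}"
      using open_UNIV by blast
    ultimately show "v \<in> \<Union> {{v \<in> fst (tch ch). snd (tch ch) v \<in> Q} | ch Q. ch \<in> atlas M \<and> open Q}"
      by blast
  qed (unfold atlas_TM, blast)
  finally show ?thesis .
qed

lemma topspace_TM: "topspace (mtop TM) = tangent_vectors M"
  unfolding topspace_TM_Union atlas_TM
  using foot_topspace by (fastforce simp: topspace_eq)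

section \<open>Charts of the tangent bundle and their transition maps\<close>

lemma inj_tch:
  assumes "ch \<in> atlas M" shows "inj_on (snd (tch ch)) (fst (tch ch))"
proof (rule inj_onI)
  fix u v assume *: "u \<in> fst (tch ch)" "v \<in> fst (tch ch)" "snd (tch ch) u = snd (tch ch) v"
  then have "foot u = foot v" using chart_inj[OF assms] by (auto dest: inj_onD)
  then show "u = v" using * assms by (intro tangent_vector_eqI[of u v ch]) (auto simp: charts_at_def)
qed

text \<open>The second factor is everything because each point carries tangent vectors with
  arbitrary coordinates. The product form yields open chart overlaps in \<open>TM\<close>.\<close>

lemma tch_image:
  assumes "ch \<in> atlas M" "ch' \<in> atlas M"
  shows "snd (tch ch) ` (fst (tch ch) \<inter> fst (tch ch')) = (snd ch ` (fst ch \<inter> fst ch')) \<times> UNIV"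
proof (rule subset_antisym)
  show "(snd ch ` (fst ch \<inter> fst ch')) \<times> UNIV \<subseteq> snd (tch ch) ` (fst (tch ch) \<inter> fst (tch ch'))"
  proof clarify
    fix q w assume q: "q \<in> fst ch" "q \<in> fst ch'"
    then have "ch \<in> charts_at M q" using assms by (simp add: charts_at_def)
    then obtain u where "u \<in> tangent_vectors M" "foot u = q" "coords u ch = w"
      by (rule tangent_vector_with_coords)
    then show "(snd ch q, w) \<in> snd (tch ch) ` (fst (tch ch) \<inter> fst (tch ch'))"
      using q by (intro image_eqI[of _ _ u]) auto
  qed
qed auto

lemma inv_tch:
  assumes "ch \<in> atlas M" "(x, w) \<in> (snd ch ` fst ch) \<times> UNIV"
  defines "u \<equiv> inv_into (fst (tch ch)) (snd (tch ch)) (x, w)"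
  shows "u \<in> tangent_vectors M" "foot u \<in> fst ch" "snd ch (foot u) = x" "coords u ch = w"
proof -
  have "(x, w) \<in> snd (tch ch) ` fst (tch ch)"
    using tch_image[OF assms(1,1)] assms(2) by simp
  from inv_into_into[OF this] f_inv_into_f[OF this]
  show "u \<in> tangent_vectors M" "foot u \<in> fst ch" "snd ch (foot u) = x" "coords u ch = w"
    unfolding u_def by auto
qed

text \<open>The vector with coordinates \<open>(x, w)\<close> keeps its foot, whose coordinates
  change by the transition map, while \<open>coords_transform\<close> changes \<open>w\<close> by
  the derivative of that map.\<close>

lemma transition_tch:
  assumes "ch \<in> atlas M" "ch' \<in> atlas M" "x \<in> snd ch ` (fst ch \<inter> fst ch')"
  shows "transition (tch ch) (tch ch') (x, w) =
      (transition ch ch' x, frechet_derivative (transition ch ch') (at x) w)"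
proof -
  let ?u = "inv_into (fst (tch ch)) (snd (tch ch)) (x, w)"
  have "(x, w) \<in> (snd ch ` fst ch) \<times> UNIV" using assms(3) by auto
  note u = inv_tch[OF assms(1) this]
  obtain q where q: "x = snd ch q" "q \<in> fst ch" "q \<in> fst ch'" using assms(3) by auto
  then have "foot ?u = q" using u(2,3) chart_inj[OF assms(1)] by (metis inj_onD)
  then have c: "ch \<in> charts_at M (foot ?u)" "ch' \<in> charts_at M (foot ?u)"
    using q assms by (auto simp: charts_at_def)
  then have "coords ?u ch' = dtrans ch ch' (foot ?u) (coords ?u ch)"
    using u(1) coords_transform by blast
  moreover have "snd ch' (foot ?u) = transition ch ch' x"
    using transition_chart[OF c(1)] u(3) by metis
  ultimately show ?thesis unfolding u(3,4) by (simp add: transition_def)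
qed

text \<open>\<open>G\<close> is the second derivative of the transition map applied to \<open>coords v ch\<close>. Joint
  differentiability of \<open>(x, w) \<mapsto> D\<tau>(x) w\<close> is reduced to that of the finitely many maps
  \<open>x \<mapsto> D\<tau>(x) c\<close> by expanding \<open>w\<close> in an orthogonal basis.\<close>

lemma derivative_transition_tch:
  assumes "ch \<in> charts_at M (foot v)" "ch' \<in> charts_at M (foot v)"
  obtains G where "linear G"
    "(transition (tch ch) (tch ch') has_derivative
      (\<lambda>z. (dtrans ch ch' (foot v) (fst z), G (fst z) + dtrans ch ch' (foot v) (snd z))))
      (at (snd (tch ch) v))"
proof -
  let ?D = "snd ch ` (fst ch \<inter> fst ch')"
  let ?\<tau> = "transition ch ch'"
  let ?p = "snd ch (foot v)" and ?w = "coords v ch"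
  have A: "ch \<in> atlas M" "ch' \<in> atlas M" "foot v \<in> fst ch" "foot v \<in> fst ch'"
    using assms by (auto simp: charts_at_def)
  obtain B :: "'e set" where B: "finite B" "span B = UNIV"
    using smooth unfolding smooth_manifold_def by blast
  from basis_orthogonal[OF B(1)] B(2) obtain C :: "'e set" where C: "finite C" "span C = UNIV" "pairwise orthogonal C"
    by auto
  let ?d = "\<lambda>c x. frechet_derivative ?\<tau> (at x) c"
  define d' where "d' c = frechet_derivative (?d c) (at ?p)" for c
  \<comment> \<open>The first order makes the derivative of \<open>?\<tau>\<close> at
    \<open>x\<close> a linear map, the second makes it differentiable in \<open>x\<close> for each
    fixed direction.\<close>
  have Ck: "Ck_on (Suc (Suc 0)) ?D ?\<tau>"
    using transition_smooth[OF A(1,2)] unfolding smooth_on_def by blast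
  have pD: "?p \<in> ?D" using A by auto
  have d': "(?d c has_derivative d' c) (at ?p)" for c
    using Ck pD unfolding d'_def by (auto simp: frechet_derivative_works)
  have expand: "?d w x = (\<Sum>c\<in>C. (w \<bullet> c / (c \<bullet> c)) *\<^sub>R ?d c x)" if "x \<in> ?D" for x w
  proof -
    have l: "linear (frechet_derivative ?\<tau> (at x))"
      using Ck that by (auto intro: linear_frechet_derivative)
    have "?d w x = ?d (\<Sum>c\<in>C. (w \<bullet> c / (c \<bullet> c)) *\<^sub>R c) x"
      using orthogonal_expansion[OF C(1,3), of w] C(2) by auto
    then show ?thesis by (simp add: linear_sum[OF l] linear_scale[OF l])
  qed
  define G where "G a = (\<Sum>c\<in>C. (?w \<bullet> c / (c \<bullet> c)) *\<^sub>R d' c a)" for a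
  have "linear (d' c)" for c using d' has_derivative_linear by blast
  then have "linear G" unfolding G_def
    by (intro linear_compose_sum linear_compose_scale_right ballI)
  have d'_fst: "((\<lambda>z. ?d c (fst z)) has_derivative (\<lambda>z. d' c (fst z))) (at (?p, ?w))" for c
    using has_derivative_compose[of fst fst "(?p, ?w)" UNIV "?d c" "d' c"] d'[of c]
    by (simp add: has_derivative_fst)
  have "((\<lambda>z. (snd z \<bullet> c / (c \<bullet> c)) *\<^sub>R ?d c (fst z)) has_derivative
     (\<lambda>z. (?w \<bullet> c / (c \<bullet> c)) *\<^sub>R d' c (fst z) + (snd z \<bullet> c / (c \<bullet> c)) *\<^sub>R ?d c ?p)) (at (?p, ?w))" for c
    unfolding divide_inverse
    by (auto intro!: derivative_eq_intros d'_fst)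
  \<comment> \<open>The product rule splits every summand in two: the first halves add up to
    \<open>G\<close>, and \<open>expand\<close> reassembles the second halves into the derivative of
    \<open>?\<tau>\<close> at \<open>?p\<close> along \<open>snd z\<close>.\<close>
  moreover have "(\<Sum>c\<in>C. (?w \<bullet> c / (c \<bullet> c)) *\<^sub>R d' c (fst z) + (snd z \<bullet> c / (c \<bullet> c)) *\<^sub>R ?d c ?p) =
      G (fst z) + ?d (snd z) ?p" for z
    unfolding G_def sum.distrib expand[OF pD, of "snd z"] ..
  ultimately
  have "((\<lambda>z. \<Sum>c\<in>C. (snd z \<bullet> c / (c \<bullet> c)) *\<^sub>R ?d c (fst z)) has_derivative
     (\<lambda>z. G (fst z) + ?d (snd z) ?p)) (at (?p, ?w))"
    using has_derivative_sum[of C "\<lambda>c z. (snd z \<bullet> c / (c \<bullet> c)) *\<^sub>R ?d c (fst z)"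
      "\<lambda>c z. (?w \<bullet> c / (c \<bullet> c)) *\<^sub>R d' c (fst z) + (snd z \<bullet> c / (c \<bullet> c)) *\<^sub>R ?d c ?p"]
    by presburger
  moreover have "((\<lambda>z. ?\<tau> (fst z)) has_derivative (\<lambda>z. dtrans ch ch' (foot v) (fst z))) (at (?p, ?w))"
    using has_derivative_compose[of fst fst "(?p, ?w)" UNIV ?\<tau> "dtrans ch ch' (foot v)"]
      transition_has_derivative[OF assms] by (simp add: has_derivative_fst)
  ultimately have "((\<lambda>z. (?\<tau> (fst z), \<Sum>c\<in>C. (snd z \<bullet> c / (c \<bullet> c)) *\<^sub>R ?d c (fst z))) has_derivative
      (\<lambda>z. (dtrans ch ch' (foot v) (fst z), G (fst z) + dtrans ch ch' (foot v) (snd z)))) (at (?p, ?w))"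
    by (intro has_derivative_Pair)
  then have "(transition (tch ch) (tch ch') has_derivative
      (\<lambda>z. (dtrans ch ch' (foot v) (fst z), G (fst z) + dtrans ch ch' (foot v) (snd z)))) (at (?p, ?w))"
  proof (rule has_derivative_transform_within_open)
    show "open (?D \<times> (UNIV :: 'e set))" using overlap_open[OF A(1,2)] by (simp add: open_Times)
    show "(?p, ?w) \<in> ?D \<times> UNIV" using pD by simp
    show "(?\<tau> (fst z), \<Sum>c\<in>C. (snd z \<bullet> c / (c \<bullet> c)) *\<^sub>R ?d c (fst z)) =
        transition (tch ch) (tch ch') z" if "z \<in> ?D \<times> UNIV" for z
      using that transition_tch[OF A(1,2), of "fst z" "snd z"] expand[of "fst z" "snd z"] by auto
  qed
  with \<open>linear G\<close> show ?thesis using that by simp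
qed

sublocale TM: c1_manifold TM
proof
  show "topspace (mtop TM) = (\<Union>T\<in>atlas TM. fst T)" by (rule topspace_TM_Union)
  show "inj_on (snd T) (fst T)" if "T \<in> atlas TM" for T
    using that inj_tch by (auto simp: atlas_TM)
  show "open (snd T ` (fst T \<inter> fst T'))" if T: "T \<in> atlas TM" "T' \<in> atlas TM" for T T'
  proof -
    obtain ch ch' where "ch \<in> atlas M" "ch' \<in> atlas M" "T = tch ch" "T' = tch ch'"
      using T unfolding atlas_TM by blast
    then show ?thesis using overlap_open by (simp only: tch_image) (simp add: open_Times)
  qed
  show "transition T T' differentiable (at (snd T v))"
    if T: "T \<in> charts_at TM v" "T' \<in> charts_at TM v" for T T' v
  proof -
    obtain ch ch' where c: "ch \<in> charts_at M (foot v)" "ch' \<in> charts_at M (foot v)"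
      "T = tch ch" "T' = tch ch'"
      using T charts_at_TM[OF charts_at_TM_tangent[OF T(1)]] by blast
    from derivative_transition_tch[OF c(1,2)] show ?thesis
      unfolding c(3,4) differentiable_def by metis
  qed
qed

lemma foot_TM: "y \<in> tangent_vectors TM \<Longrightarrow> foot y \<in> tangent_vectors M"
  using TM.foot_topspace topspace_TM by blast

text \<open>The base component of \<open>y\<close> transforms by \<open>dtrans\<close> alone, so it
  represents a tangent vector of \<open>M\<close>. If it is 0, the linear term \<open>G\<close>
  drops out and the fibre component transforms in the same way.\<close>

lemma coords_TM_transform:
  assumes "y \<in> tangent_vectors TM" "ch \<in> charts_at M (foot (foot y))"
    "ch' \<in> charts_at M (foot (foot y))"
  obtains G where "linear G"
    "coords y (tch ch') = (dtrans ch ch' (foot (foot y)) (fst (coords y (tch ch))),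
      G (fst (coords y (tch ch))) + dtrans ch ch' (foot (foot y)) (snd (coords y (tch ch))))"
proof -
  obtain G where G: "linear G" "(transition (tch ch) (tch ch') has_derivative
      (\<lambda>z. (dtrans ch ch' (foot (foot y)) (fst z), G (fst z) + dtrans ch ch' (foot (foot y)) (snd z))))
      (at (snd (tch ch) (foot y)))"
    using derivative_transition_tch[OF assms(2,3)] by blast
  have "tch ch \<in> charts_at TM (foot y)" "tch ch' \<in> charts_at TM (foot y)"
    using assms(2,3) unfolding charts_at_TM[OF foot_TM[OF assms(1)]] by blast+
  then have "coords y (tch ch') = TM.dtrans (tch ch) (tch ch') (foot y) (coords y (tch ch))"
    using assms(1) TM.coords_transform by blast
  then show ?thesis
    unfolding frechet_derivative_at[OF G(2), symmetric] by (rule that[OF G(1)])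
qed

section \<open>The tangent map of the projection, and the vertical bundle\<close>

lemma foot_proj_map [simp]: "foot (proj_map M y) = foot (foot y)"
  by (simp add: proj_map_def tangent_map_def Let_def)

text \<open>Between \<open>tch ch\<close> and \<open>ch\<close> the projection reads
  \<open>(x, w) \<mapsto> x\<close>, with derivative \<open>fst\<close>. As
  \<open>tangent_map\<close> picks its source chart by \<open>SOME\<close>, the derivative is
  computed in that chart \<open>tch ch0\<close> and then compared with \<open>tch ch\<close> through
  \<open>coords_TM_transform\<close>.\<close>

lemma coords_proj_map:
  assumes y: "y \<in> tangent_vectors TM"
  shows "coords (proj_map M y) ch =
    (if ch \<in> charts_at M (foot (foot y)) then fst (coords y (tch ch)) else 0)"
proof (cases "ch \<in> charts_at M (foot (foot y))")
  case False
  then show ?thesis by (simp add: proj_map_def tangent_map_def Let_def)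
next
  case ch: True
  have v: "foot y \<in> tangent_vectors M" using y by (rule foot_TM)
  define T where "T = (SOME T. T \<in> charts_at TM (foot y))"
  have "\<exists>T. T \<in> charts_at TM (foot y)" using ch charts_at_TM[OF v] by blast
  then have "T \<in> charts_at TM (foot y)" unfolding T_def by (rule someI_ex)
  then obtain ch0 where ch0: "T = tch ch0" "ch0 \<in> charts_at M (foot (foot y))"
    using charts_at_TM[OF v] by blast
  have A: "ch0 \<in> atlas M" "ch \<in> atlas M" "foot (foot y) \<in> fst ch0" "foot (foot y) \<in> fst ch"
    using ch ch0(2) by (auto simp: charts_at_def)
  let ?D = "snd ch0 ` (fst ch0 \<inter> fst ch)"
  let ?x = "snd (tch ch0) (foot y)"
  have "((\<lambda>z. snd ch (foot (inv_into (fst (tch ch0)) (snd (tch ch0)) z))) has_derivative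
      (\<lambda>z. dtrans ch0 ch (foot (foot y)) (fst z))) (at ?x)"
  proof (rule has_derivative_transform_within_open)
    show "((\<lambda>z. transition ch0 ch (fst z)) has_derivative
        (\<lambda>z. dtrans ch0 ch (foot (foot y)) (fst z))) (at ?x)"
      using has_derivative_compose[of fst fst ?x UNIV "transition ch0 ch"]
        transition_has_derivative[OF ch0(2) ch] by (simp add: has_derivative_fst)
    show "open (?D \<times> (UNIV :: 'e set))" using overlap_open[OF A(1,2)] by (simp add: open_Times)
    show "?x \<in> ?D \<times> UNIV" using A by auto
    show "transition ch0 ch (fst z) = snd ch (foot (inv_into (fst (tch ch0)) (snd (tch ch0)) z))"
      if "z \<in> ?D \<times> UNIV" for z
    proof -
      \<comment> \<open>The first component of \<open>snd (tch ch)\<close> is \<open>snd ch\<close>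
        of the foot, so the first component of the transition map is the projection in
        coordinates.\<close>
      have "fst (transition (tch ch0) (tch ch) z) = transition ch0 ch (fst z)"
        using that transition_tch[OF A(1,2), of "fst z" "snd z"] by (simp add: mem_Times_iff)
      then show ?thesis by (simp add: transition_def[of "tch ch0"])
    qed
  qed
  note d = frechet_derivative_at[OF this, symmetric]
  have "coords (proj_map M y) ch =
      frechet_derivative (\<lambda>z. snd ch (foot (inv_into (fst (tch ch0)) (snd (tch ch0)) z))) (at ?x)
        (coords y (tch ch0))"
    using ch unfolding proj_map_def tangent_map_def T_def[symmetric] ch0(1) Let_def
    by (simp del: tch_simps)
  also have "\<dots> = dtrans ch0 ch (foot (foot y)) (fst (coords y (tch ch0)))"
    unfolding d ..
  also have "\<dots> = fst (coords y (tch ch))"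
    by (rule coords_TM_transform[OF y ch0(2) ch]) simp
  finally show ?thesis using ch by simp
qed

lemma proj_map_tangent:
  assumes y: "y \<in> tangent_vectors TM"
  shows "proj_map M y \<in> tangent_vectors M"
proof (rule tangent_vectorsI)
  fix ch ch' assume "ch \<in> charts_at M (foot (proj_map M y))" "ch' \<in> charts_at M (foot (proj_map M y))"
  then have c: "ch \<in> charts_at M (foot (foot y))" "ch' \<in> charts_at M (foot (foot y))" by simp_all
  have "fst (coords y (tch ch')) = dtrans ch ch' (foot (foot y)) (fst (coords y (tch ch)))"
    by (rule coords_TM_transform[OF y c]) simp
  then show "coords (proj_map M y) ch' = dtrans ch ch' (foot (proj_map M y)) (coords (proj_map M y) ch)"
    using c by (simp add: coords_proj_map[OF y])
qed (use y foot_topspace[OF foot_TM[OF y]] in \<open>simp_all add: coords_proj_map\<close>)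

lemma proj_map_tminus:
  assumes "y \<in> tangent_vectors TM" "z \<in> tangent_vectors TM" "foot y = foot z"
  shows "proj_map M (tminus y z) = tminus (proj_map M y) (proj_map M z)"
  using assms by - (rule tvec_eqI, simp_all add: coords_proj_map TM.tangent_vectors_tminus)

lemma vertical_iff:
  "y \<in> vertical_bundle M \<longleftrightarrow> y \<in> tangent_vectors TM \<and>
     (\<forall>ch\<in>charts_at M (foot (foot y)). fst (coords y (tch ch)) = 0)"
proof (cases "y \<in> tangent_vectors TM")
  case True
  have "proj_map M y = tzero (foot (foot y)) \<longleftrightarrow> (\<forall>ch. coords (proj_map M y) ch = 0)"
    by (metis coords_simps(1) foot_proj_map foot_simps(1) tvec_eqI)
  also have "\<dots> \<longleftrightarrow> (\<forall>ch\<in>charts_at M (foot (foot y)). fst (coords y (tch ch)) = 0)"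
    unfolding coords_proj_map[OF True] by meson
  finally show ?thesis using True by (simp add: vertical_bundle_def)
qed (simp add: vertical_bundle_def)

lemma vertical_tminus:
  assumes "y \<in> fiber (vertical_bundle M) v" "z \<in> fiber (vertical_bundle M) v"
  shows "tminus y z \<in> fiber (vertical_bundle M) v"
  using assms by (auto simp: fiber_def vertical_iff TM.tangent_vectors_tminus)

section \<open>The vertical lift\<close>

lemma foot_vertical_lift [simp]: "foot (vertical_lift M v w) = v"
  by (auto simp: vertical_lift_def intro: tvec_eqI)

text \<open>The line \<open>v + s w\<close> stays over one point of \<open>M\<close>, and its fibre
  coordinates are affine in \<open>s\<close> with slope \<open>coords w ch\<close>.\<close>

lemma coords_vertical_lift:
  assumes "v \<in> tangent_vectors M"
  shows "ch \<in> charts_at M (foot v) \<Longrightarrow> coords (vertical_lift M v w) (tch ch) = (0, coords w ch)"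
    and "T \<notin> charts_at TM v \<Longrightarrow> coords (vertical_lift M v w) T = 0"
proof -
  \<comment> \<open>The foot of the velocity at time 0 is this sum; it must be recognized as
    \<open>v\<close> before the charts at \<open>v\<close> apply.\<close>
  have v: "tadd v (tscale 0 w) = v" by (rule tvec_eqI) simp_all
  show "T \<notin> charts_at TM v \<Longrightarrow> coords (vertical_lift M v w) T = 0"
    by (simp add: vertical_lift_def velocity_def v)
  have "((\<lambda>s. (snd ch (foot v), coords v ch + s *\<^sub>R coords w ch)) has_vector_derivative
      (0, coords w ch)) (at 0)"
    by (auto intro!: derivative_eq_intros has_vector_derivative_Pair)
  from vector_derivative_at[OF this]
  show "ch \<in> charts_at M (foot v) \<Longrightarrow> coords (vertical_lift M v w) (tch ch) = (0, coords w ch)"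
    using assms by (simp add: vertical_lift_def velocity_def v charts_at_TM)
qed

lemma vertical_lift_inj:
  assumes v: "v \<in> tangent_vectors M" and "w \<in> tangent_space M (foot v)" "w' \<in> tangent_space M (foot v)"
    and "vertical_lift M v w = vertical_lift M v w'"
  shows "w = w'"
proof -
  obtain ch where "ch \<in> charts_at M (foot v)"
    using v charts_at_exists foot_topspace by blast
  then show ?thesis
    using assms coords_vertical_lift(1)[OF v, of ch w] coords_vertical_lift(1)[OF v, of ch w']
    by (intro tangent_vector_eqI[of w w' ch]) (auto simp: tangent_space_def)
qed

text \<open>The preimage collects the fibre components of \<open>y\<close>. They transform as
  coordinates of a tangent vector since the base components of a vertical vector vanish, and the
  term \<open>G\<close> with them.\<close>

lemma vertical_lift_surj:
  assumes y: "y \<in> fiber (vertical_bundle M) v"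
  obtains w where "w \<in> tangent_space M (foot v)" "vertical_lift M v w = y"
proof
  have y1: "y \<in> tangent_vectors TM" "foot y = v"
    and y0: "\<And>ch. ch \<in> charts_at M (foot v) \<Longrightarrow> fst (coords y (tch ch)) = 0"
    using y by (auto simp: fiber_def vertical_iff)
  have v: "v \<in> tangent_vectors M" using y1 foot_TM by blast
  let ?w = "TVec (foot v) (\<lambda>ch. if ch \<in> charts_at M (foot v) then snd (coords y (tch ch)) else 0)"
  have "?w \<in> tangent_vectors M"
  proof (rule tangent_vectorsI)
    fix ch ch' assume "ch \<in> charts_at M (foot ?w)" "ch' \<in> charts_at M (foot ?w)"
    then have c: "ch \<in> charts_at M (foot v)" "ch' \<in> charts_at M (foot v)" by simp_all
    have "snd (coords y (tch ch')) = dtrans ch ch' (foot v) (snd (coords y (tch ch)))"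
      by (rule coords_TM_transform[OF y1(1), unfolded y1(2), OF c])
        (simp add: y0[OF c(1)] linear_0)
    then show "coords ?w ch' = dtrans ch ch' (foot ?w) (coords ?w ch)" using c by simp
  qed (use foot_topspace[OF v] in simp_all)
  then show "?w \<in> tangent_space M (foot v)" by (simp add: tangent_space_def)
  show "vertical_lift M v ?w = y"
  proof (rule tvec_eqI)
    show "foot (vertical_lift M v ?w) = foot y" using y1 by simp
    show "coords (vertical_lift M v ?w) T = coords y T" for T
    proof (cases "T \<in> charts_at TM v")
      case True
      then obtain ch where "T = tch ch" "ch \<in> charts_at M (foot v)"
        using charts_at_TM[OF v] by blast
      then show ?thesis
        using coords_vertical_lift(1)[OF v, of ch ?w] y0[of ch] by (simp add: prod_eqI)
    next
      case False
      then show ?thesis using coords_vertical_lift(2)[OF v] y1 by (simp add: TM.coords_outside)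
    qed
  qed
qed

lemma vertical_lift_tzero:
  assumes v: "v \<in> tangent_vectors M"
  shows "vertical_lift M v (tzero (foot v)) = tzero v"
proof (rule tvec_eqI)
  show "coords (vertical_lift M v (tzero (foot v))) T = coords (tzero v) T" for T
    using coords_vertical_lift[OF v, of _ "tzero (foot v)"] charts_at_TM[OF v]
    by (cases "T \<in> charts_at TM v") (auto simp: zero_prod_def)
qed simp

text \<open>The lift is a bijection from the tangent space onto the vertical fibre, so the
  description in \<open>vertical_ident\<close> denotes the unique preimage; and the lift sends zero
  to zero.\<close>

lemma vertical_ident_eq_tzero_iff:
  assumes y: "y \<in> fiber (vertical_bundle M) v"
  shows "vertical_ident M y = tzero (foot v) \<longleftrightarrow> y = tzero v"
proof -
  have fy: "foot y = v" and v: "v \<in> tangent_vectors M"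
    using y foot_TM by (auto simp: fiber_def vertical_iff)
  have z: "tzero (foot v) \<in> tangent_space M (foot v)"
    using v by (simp add: tangent_space_def tangent_vectors_tzero foot_topspace)
  obtain w where w: "w \<in> tangent_space M (foot v)" "vertical_lift M v w = y"
    using vertical_lift_surj[OF y] .
  have "vertical_ident M y = w"
    unfolding vertical_ident_def fy using w vertical_lift_inj[OF v] by (intro the_equality) blast+
  then show ?thesis using w z vertical_lift_inj[OF v] vertical_lift_tzero[OF v] by metis
qed

section \<open>Horizontal spaces\<close>

context
  fixes H
  assumes connection: "connection M H"
begin

lemma H_fiber_tangent: "h \<in> fiber H v \<Longrightarrow> h \<in> tangent_vectors TM \<and> foot h = v"
  using connection by (auto simp: connection_def smooth_subbundle_def fiber_def)

text \<open>A local frame presents the fibre as all linear combinations of fixed vectors, and these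
  are subtracted coefficientwise.\<close>

lemma H_tminus:
  assumes "h \<in> fiber H v" "h' \<in> fiber H v"
  shows "tminus h h' \<in> fiber H v"
proof -
  have "v \<in> topspace (mtop TM)"
    using H_fiber_tangent[OF assms(1)] TM.foot_topspace by blast
  then obtain k X where E: "fiber H v = range (\<lambda>a. tlincomb v k a X)"
    using connection unfolding connection_def smooth_subbundle_def by meson
  then obtain a b where "h = tlincomb v k a X" "h' = tlincomb v k b X" using assms by auto
  then have "tminus h h' = tlincomb v k (\<lambda>i. a i - b i) X"
    by (simp add: tminus_def tlincomb_def sum_subtractf scaleR_diff_left)
  then show ?thesis using E by auto
qed

lemma H_int_V: "v \<in> tangent_vectors M \<Longrightarrow> fiber H v \<inter> fiber (vertical_bundle M) v = {tzero v}"
  using connection by (auto simp: connection_def)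

lemma H_V_decomposition:
  assumes "z \<in> tangent_vectors TM" "foot z = v"
  obtains h y where "h \<in> fiber H v" "y \<in> fiber (vertical_bundle M) v" "z = tadd h y"
proof -
  have "v \<in> tangent_vectors M" using assms foot_TM by blast
  then have "z \<in> {tadd h y | h y. h \<in> fiber H v \<and> y \<in> fiber (vertical_bundle M) v}"
    using connection assms by (simp add: connection_def tangent_space_def)
  then show ?thesis using that by blast
qed

text \<open>If \<open>h + y = h' + y'\<close>, then \<open>h' - h = y - y'\<close> is both
  horizontal and vertical, hence zero. So the description in \<open>horizontal_part\<close> has a
  unique solution.\<close>

lemma horizontal_part_tadd:
  assumes "h \<in> fiber H v" "y \<in> fiber (vertical_bundle M) v"
  shows "horizontal_part M H (tadd h y) = h"
  unfolding horizontal_part_def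
proof (rule the_equality)
  have f: "foot h = v" "foot (tadd h y) = v" using assms(1) by (simp_all add: fiber_def)
  show "h \<in> fiber H (foot (tadd h y)) \<and>
      (\<exists>y'\<in>fiber (vertical_bundle M) (foot (tadd h y)). tadd h y = tadd h y')"
    unfolding f using assms by blast
  fix h' assume "h' \<in> fiber H (foot (tadd h y)) \<and>
      (\<exists>y'\<in>fiber (vertical_bundle M) (foot (tadd h y)). tadd h y = tadd h' y')"
  then obtain y' where h': "h' \<in> fiber H v" "y' \<in> fiber (vertical_bundle M) v" "tadd h y = tadd h' y'"
    unfolding f by blast
  have "tminus h' h = tminus y y'"
  proof (rule tvec_eqI)
    show "foot (tminus h' h) = foot (tminus y y')" using h'(1) assms(2) by (simp add: fiber_def)
    show "coords (tminus h' h) T = coords (tminus y y') T" for T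
    proof -
      have "coords h' T = coords h T + coords y T - coords y' T"
        using arg_cong[OF h'(3), of "\<lambda>u. coords u T"] by simp
      then show ?thesis by (simp only: coords_simps) (simp add: algebra_simps)
    qed
  qed
  moreover have "v \<in> tangent_vectors M"
    using H_fiber_tangent[OF assms(1)] foot_TM by blast
  ultimately have "tminus h' h = tzero v"
    using H_int_V H_tminus[OF h'(1) assms(1)] vertical_tminus[OF assms(2) h'(2)] by (metis IntI singletonD)
  then show "h' = h" using h'(1) f(1) by - (rule tminus_eq_tzeroD, simp_all add: fiber_def)
qed

text \<open>For \<open>z = h + y\<close> the connector is \<open>vertical_ident M y\<close>, so its
  vanishing depends on the vertical part alone.\<close>

lemma connector_eq_tzero_iff:
  assumes "z \<in> tangent_vectors TM" "foot z = v"
  shows "connector M H z = tzero (foot v) \<longleftrightarrow> z \<in> fiber H v"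
proof -
  obtain h y where hy: "h \<in> fiber H v" "y \<in> fiber (vertical_bundle M) v" "z = tadd h y"
    using H_V_decomposition[OF assms] .
  have v: "v \<in> tangent_vectors M" using assms foot_TM by blast
  have y: "tminus z h = y"
    using hy by - (rule tvec_eqI, auto simp: fiber_def)
  have "connector M H z = vertical_ident M y"
    unfolding connector_def using horizontal_part_tadd[OF hy(1,2)] hy(3) y by simp
  then have "connector M H z = tzero (foot v) \<longleftrightarrow> y = tzero v"
    using vertical_ident_eq_tzero_iff[OF hy(2)] by simp
  also have "\<dots> \<longleftrightarrow> z \<in> fiber H v"
  proof
    assume "y = tzero v"
    then have "z = h" using y hy by - (rule tminus_eq_tzeroD[of z h v], auto simp: fiber_def)
    then show "z \<in> fiber H v" using hy by simp
  next
    assume "z \<in> fiber H v"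
    \<comment> \<open>Being \<open>z - h\<close>, the vertical part is a difference of horizontal
      vectors.\<close>
    then have "y \<in> fiber H v" using H_tminus[OF _ hy(1)] y by metis
    then show "y = tzero v" using hy(2) H_int_V[OF v] by auto
  qed
  finally show ?thesis .
qed

text \<open>\<open>inv_into\<close> yields a genuine preimage only if some horizontal vector lies
  over \<open>v\<close>. The horizontal part of \<open>z\<close> does, as the vertical part projects
  to zero. Two horizontal vectors over \<open>v\<close> differ by a vertical one and hence
  agree.\<close>

lemma eq_quasispray_iff:
  assumes z: "z \<in> tangent_vectors TM" "foot z = v" "proj_map M z = v"
  shows "z = geodesic_quasispray M H v \<longleftrightarrow> z \<in> fiber H v"
proof -
  obtain h y where hy: "h \<in> fiber H v" "y \<in> fiber (vertical_bundle M) v" "z = tadd h y"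
    using H_V_decomposition[OF z(1,2)] .
  have v: "v \<in> tangent_vectors M" using z foot_TM by blast
  have h: "h \<in> tangent_vectors TM" "foot h = v" using H_fiber_tangent hy(1) by auto
  have y: "y \<in> tangent_vectors TM" "foot y = v" "proj_map M y = tzero (foot v)"
    using hy(2) by (simp_all add: fiber_def vertical_bundle_def)
  have "proj_map M h = v"
  proof (rule tvec_eqI)
    have "coords (proj_map M h) ch = coords (proj_map M z) ch" for ch
      using hy(2,3) h z(1,2) by (simp add: coords_proj_map fiber_def vertical_iff)
    then show "coords (proj_map M h) ch = coords v ch" for ch using z(3) by simp
  qed (use h in simp)
  then have ex: "v \<in> proj_map M ` fiber H v" using hy(1) by force
  let ?S = "geodesic_quasispray M H v"
  have S: "?S \<in> fiber H v" "proj_map M ?S = v"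
    using inv_into_into[OF ex] f_inv_into_f[OF ex] by (auto simp: geodesic_quasispray_def)
  show ?thesis
  proof
    assume zH: "z \<in> fiber H v"
    let ?d = "tminus z ?S"
    have T: "?S \<in> tangent_vectors TM" "foot ?S = v" using S H_fiber_tangent by auto
    have "proj_map M ?d = tminus v v" using T z S by (simp add: proj_map_tminus)
    also have "\<dots> = tzero (foot v)" by (rule tvec_eqI) auto
    finally have "?d \<in> fiber (vertical_bundle M) v"
      using T z TM.tangent_vectors_tminus by (auto simp: vertical_bundle_def fiber_def)
    then have "?d = tzero v" using H_tminus[OF zH S(1)] H_int_V[OF v] by auto
    then show "z = ?S" using tminus_eq_tzeroD z T by metis
  qed (use S in simp)
qed

end

section \<open>The velocity lift of a curve\<close>

text \<open>The identity is the only chart of the real line, so it disappears from the definition of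
  smoothness.\<close>

lemma smooth_curve_chart:
  assumes "smooth_curve M I c" "t \<in> I"
  obtains ch W where "ch \<in> charts_at M (c t)" "open W" "t \<in> W" "W \<subseteq> I"
    "\<forall>s\<in>W. c s \<in> fst ch" "\<forall>k. Ck_on k W (\<lambda>s. snd ch (c s))"
proof -
  have "smooth_map_on euclidean_manifold M I c"
    using assms(1) by (simp add: smooth_curve_def)
  then obtain ch0 ch W where ch: "ch0 \<in> charts_at euclidean_manifold t" "ch \<in> charts_at M (c t)"
    and W: "openin (mtop (euclidean_manifold :: (real, real) manifold)) W" "t \<in> W"
      "W \<subseteq> I \<inter> fst ch0" "c ` W \<subseteq> fst ch"
      "smooth_on (snd ch0 ` W) (\<lambda>x. snd ch (c (inv_into (fst ch0) (snd ch0) x)))"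
    using assms(2) unfolding smooth_map_on_def case_prod_unfold by meson
  have "ch0 = (UNIV, id)" using ch(1) by (simp add: charts_at_def euclidean_manifold_def)
  then show ?thesis
    using that[of ch W] ch(2) W by (auto simp: smooth_on_def euclidean_manifold_def)
qed

context
  fixes I c
  assumes c: "smooth_curve M I c"
begin

text \<open>A chart and a neighbourhood that serve for \<open>c\<close> serve for its lift, which
  reads \<open>(x, x')\<close> in \<open>tch ch\<close> when \<open>c\<close> reads \<open>x\<close>
  in \<open>ch\<close>.\<close>

lemma velocity_lift_chart:
  assumes "t \<in> I"
  obtains ch W where "ch \<in> charts_at M (c t)" "open W" "t \<in> W" "W \<subseteq> I"
    "\<forall>s\<in>W. velocity M c s \<in> fst (tch ch)"
    "\<forall>k. Ck_on k W (\<lambda>s. snd (tch ch) (velocity M c s))"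
    "\<forall>s\<in>W. (\<lambda>s. snd ch (c s)) differentiable (at s)"
    "\<forall>s\<in>W. coords (velocity M c s) ch = vector_derivative (\<lambda>s. snd ch (c s)) (at s)"
proof -
  obtain ch W where W: "ch \<in> charts_at M (c t)" "open W" "t \<in> W" "W \<subseteq> I"
    "\<forall>s\<in>W. c s \<in> fst ch" "\<forall>k. Ck_on k W (\<lambda>s. snd ch (c s))"
    using smooth_curve_chart[OF c assms] .
  have ch: "ch \<in> charts_at M (c s)" if "s \<in> W" for s
    using W(1,5) that by (simp add: charts_at_def)
  have diff: "(\<lambda>s. snd ch (c s)) differentiable (at s)" if "s \<in> W" for s
    using W(6)[rule_format, of "Suc 0"] that by simp
  have "velocity M c s \<in> tangent_vectors M" if "s \<in> W" for s
    using velocity_tangent[of ch c s W, OF ch[OF that] W(2) that] W(5) W(6)[rule_format, of 0] diff[OF that]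
    by (simp add: vector_derivative_works)
  then have 1: "velocity M c s \<in> fst (tch ch)" if "s \<in> W" for s
    using that W(5) by simp
  have 2: "coords (velocity M c s) ch = vector_derivative (\<lambda>s. snd ch (c s)) (at s)" if "s \<in> W" for s
    using ch[OF that] by (simp add: velocity_def)
  have "Ck_on k W (\<lambda>s. snd (tch ch) (velocity M c s))" for k
  proof (rule Ck_on_cong[OF W(2)])
    \<comment> \<open>Order \<open>k\<close> of the derivative costs order \<open>Suc k\<close> of
      the curve, and all orders are available.\<close>
    show "Ck_on k W (\<lambda>s. (snd ch (c s), vector_derivative (\<lambda>s. snd ch (c s)) (at s)))"
      using W(2,6) by (intro Ck_on_Pair Ck_on_vector_derivative) blast+
  qed (simp add: 2)
  with that[OF W(1-4)] 1 diff 2 show ?thesis by blast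
qed

text \<open>Through \<open>integral_curve\<close>, the definition of \<open>geodesic\<close> also
  demands smoothness of the lift in \<open>TM\<close>; this settles that demand.\<close>

lemma smooth_curve_velocity: "smooth_curve TM I (velocity M c)"
  unfolding smooth_curve_def smooth_map_on_def
proof (intro conjI ballI)
  show "open I" "is_interval I" "openin (mtop (euclidean_manifold :: (real, real) manifold)) I"
    using c by (auto simp: smooth_curve_def smooth_map_on_def)
  fix t assume "t \<in> I"
  then obtain ch W where W: "ch \<in> charts_at M (c t)" "open W" "t \<in> W" "W \<subseteq> I"
    "\<forall>s\<in>W. velocity M c s \<in> fst (tch ch)"
    "\<forall>k. Ck_on k W (\<lambda>s. snd (tch ch) (velocity M c s))"
    using velocity_lift_chart by metis
  have "(UNIV, id) \<in> charts_at (euclidean_manifold :: (real, real) manifold) t"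
    by (simp add: charts_at_def euclidean_manifold_def)
  moreover have "tch ch \<in> charts_at TM (velocity M c t)"
    using W(1,3,5) by (simp add: charts_at_def atlas_TM)
  moreover have "velocity M c ` W \<subseteq> fst (tch ch)" using W(5) by blast
  moreover have "smooth_on W (\<lambda>s. snd (tch ch) (velocity M c s))"
    using W(2,6) by (simp add: smooth_on_def)
  ultimately show "\<exists>(U, \<phi>)\<in>charts_at (euclidean_manifold :: (real, real) manifold) t.
      \<exists>(V, \<psi>)\<in>charts_at TM (velocity M c t). \<exists>W'.
        openin (mtop (euclidean_manifold :: (real, real) manifold)) W' \<and> t \<in> W' \<and> W' \<subseteq> I \<inter> U \<and>
        velocity M c ` W' \<subseteq> V \<and> smooth_on (\<phi> ` W') (\<lambda>x. \<psi> (velocity M c (inv_into U \<phi> x)))"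
    using W(2-4)
    by (intro bexI[of _ "(UNIV, id)"] bexI[of _ "tch ch"] case_prodI2 exI[of _ W])
       (auto simp: case_prod_unfold euclidean_manifold_def)
qed

text \<open>The lift reads \<open>(x, x')\<close>, so its derivative is \<open>(x', x'')\<close>,
  whose base component gives the coordinates of the velocity. Both facts are what
  \<open>eq_quasispray_iff\<close> asks of \<open>z\<close>.\<close>

lemma acceleration:
  assumes "t \<in> I"
  shows "velocity TM (velocity M c) t \<in> tangent_vectors TM"
    and "proj_map M (velocity TM (velocity M c) t) = velocity M c t"
proof -
  let ?z = "velocity TM (velocity M c) t"
  obtain ch W where W: "ch \<in> charts_at M (c t)" "open W" "t \<in> W" "W \<subseteq> I"
    "\<forall>s\<in>W. velocity M c s \<in> fst (tch ch)"
    "\<forall>k. Ck_on k W (\<lambda>s. snd (tch ch) (velocity M c s))"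
    "\<forall>s\<in>W. (\<lambda>s. snd ch (c s)) differentiable (at s)"
    "\<forall>s\<in>W. coords (velocity M c s) ch = vector_derivative (\<lambda>s. snd ch (c s)) (at s)"
    using velocity_lift_chart[OF assms] .
  have v: "velocity M c t \<in> tangent_vectors M" using W(3,5) by simp
  have T: "tch ch \<in> charts_at TM (velocity M c t)"
    using W(1) v by (simp add: charts_at_TM)
  have "(\<lambda>s. snd (tch ch) (velocity M c s)) differentiable (at t)"
    using W(3) W(6)[rule_format, of "Suc 0"] by simp
  then obtain d where d: "((\<lambda>s. snd (tch ch) (velocity M c s)) has_vector_derivative d) (at t)"
    using vector_derivative_works by blast
  show z: "?z \<in> tangent_vectors TM"
    using TM.velocity_tangent[of _ "velocity M c" t, OF T W(2,3) _ _ d] W(5) W(6)[rule_format, of 0] by simp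
  \<comment> \<open>The first component of the lift in \<open>tch ch\<close> is \<open>c\<close>
    read in \<open>ch\<close>, so \<open>fst d\<close> is its derivative.\<close>
  have "((\<lambda>s. snd ch (c s)) has_vector_derivative fst d) (at t)"
    using has_derivative_fst[OF d[unfolded has_vector_derivative_def]]
    by (simp add: has_vector_derivative_def)
  then have "fst d = coords (velocity M c t) ch"
    using W(3,8) vector_derivative_at by metis
  moreover have "coords ?z (tch ch) = d"
    using T vector_derivative_at[OF d] by (simp add: velocity_def[of TM])
  ultimately have "fst (coords ?z (tch ch)) = coords (velocity M c t) ch" by simp
  moreover have "proj_map M ?z \<in> tangent_vectors M"
    using z by (rule proj_map_tangent)
  ultimately show "proj_map M ?z = velocity M c t"
    using v W(1) z by (intro tangent_vector_eqI[of _ _ ch]) (simp_all add: coords_proj_map)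
qed

end

end

theorem theorem4p13:
  fixes M :: "('a, 'e::real_inner) manifold"
    and H :: "('a, 'e) ttvec set"
    and I :: "real set"
    and c :: "real \<Rightarrow> 'a"
  assumes "smooth_manifold M"
    and "connection M H"
    and "smooth_curve M I c"
  shows "geodesic M H I c \<longleftrightarrow>
    (\<forall>t\<in>I. covariant_derivative_along M H (velocity M c) t = tzero (c t))"
proof -
  interpret smooth_mfd M by unfold_locales fact
  \<comment> \<open>Both equations say that the acceleration lies in the fibre of \<open>H\<close>
    over the velocity.\<close>
  have "velocity TM (velocity M c) t = geodesic_quasispray M H (velocity M c t) \<longleftrightarrow>
      covariant_derivative_along M H (velocity M c) t = tzero (c t)" if "t \<in> I" for t
    using eq_quasispray_iff[OF assms(2), of _ "velocity M c t"]
      connector_eq_tzero_iff[OF assms(2), of _ "velocity M c t"] acceleration[OF assms(3) that]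
    by (simp add: covariant_derivative_along_def)
  \<comment> \<open>The smoothness clauses of \<open>geodesic\<close> hold, which leaves the
    equations at the times in \<open>I\<close>.\<close>
  then show ?thesis
    using assms(3) smooth_curve_velocity[OF assms(3)] by (simp add: geodesic_def integral_curve_def)
qed

end
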